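(* Let $n\ge2$. A vector $c=(c_1,\dots,c_{n-1})$ is a UM vector of length $n-1$ if and only if it is the vector of simple-root coordinates of an element $c=\sum_i c_i\alpha_i$ of the coroot lattice of $A_{n-1}$ such that $-1\le (c,r)\le 2$ for every positive root $r$. That is, UM vectors are exactly the coroot lattice points inside the polytope defined by the affine hyperplanes at heights $-1$ and $2$ orthogonal to every positive root.
   Context: The root system $A_{n-1}$ lives in $V=\{x\in\mathbb{R}^n:\sum x_i=0\}$ with the standard inner product $(\cdot,\cdot)$; simple roots are $\alpha_i=e_i-e_{i+1}$ ($1\le i\le n-1$), positive roots are $e_i-e_j$ ($i<j$), and the coroot lattice is $\bigoplus_i\mathbb{Z}\alpha_i$. For $\pi\in\mathfrak{S}_n$ with permutation matrix $(\pi_{a,b})$, the Waldspurger matrix $\mathbf{WT}(\pi)$ is the $(n-1)\times(n-1)$ matrix with $$\mathbf{WT}(\pi)_{i,j}=\begin{cases}\sum_{a\le i,\ b>j}\pi_{a,b} & i\le j,\\ \sum_{a>i,\ b\le j}\pi_{a,b} & i\ge j\end{cases}$$ (the formulas agree for $i=j$). A UM vector of length $n-1$ is any vector that appears as a column of $\mathbf{WT}(\pi)$ for some $\pi\in\mathfrak{S}_n$. *)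

theory Defs
  imports Complex_Main "HOL-Combinatorics.Permutations" "Jordan_Normal_Form.Matrix"
begin

text \<open>
  Vector and matrix indices start at 0, so row, column and coordinate \<open>k\<close> below is the one
  usually numbered \<open>k + 1\<close>; permutations act on \<open>{..<n}\<close>.  Since \<open>i\<close>, \<open>j\<close>, \<open>a\<close>, \<open>b\<close> are all
  shifted by the same amount, the conditions \<open>a \<le> i\<close>, \<open>b > j\<close>, ... keep their usual form.
\<close>

subsection \<open>The root system of type A\<close>

definition ambient_space :: "nat \<Rightarrow> real vec set" where
  "ambient_space n = {x \<in> carrier_vec n. (\<Sum>i<n. x $ i) = 0}"

definition simple_root :: "nat \<Rightarrow> nat \<Rightarrow> real vec" where
  "simple_root n i = unit_vec n i - unit_vec n (i + 1)"

definition positive_roots :: "nat \<Rightarrow> real vec set" where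
  "positive_roots n = {unit_vec n i - unit_vec n j | i j. i < j \<and> j < n}"

definition simple_root_comb :: "nat \<Rightarrow> real vec \<Rightarrow> real vec" where
  "simple_root_comb n c = finsum_vec TYPE(real) n (\<lambda>i. c $ i \<cdot>\<^sub>v simple_root n i) {..<n - 1}"

definition coroot_lattice :: "nat \<Rightarrow> real vec set" where
  "coroot_lattice n =
     {simple_root_comb n (map_vec real_of_int k) | k. k \<in> carrier_vec (n - 1)}"

definition height_polytope :: "nat \<Rightarrow> real vec set" where
  "height_polytope n =
     {x \<in> ambient_space n. \<forall>r\<in>positive_roots n. -1 \<le> x \<bullet> r \<and> x \<bullet> r \<le> 2}"

subsection \<open>Waldspurger matrices and UM vectors\<close>

text \<open>
  The opposite convention for permutation matrices replaces each Waldspurger matrix by its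
  transpose.  The set of UM vectors is the same in both cases, because column \<open>j\<close> of the matrix
  of \<open>\<pi>\<close> depends only on the \<open>(j + 1)\<close>-element set \<open>{a. \<pi> a \<le> j}\<close>, and row \<open>j\<close> depends in the
  same way on \<open>\<pi> ` {..j}\<close>.
\<close>

definition permutation_matrix :: "nat \<Rightarrow> (nat \<Rightarrow> nat) \<Rightarrow> real mat" where
  "permutation_matrix n \<pi> = mat n n (\<lambda>(a, b). if \<pi> a = b then 1 else 0)"

definition waldspurger_matrix :: "nat \<Rightarrow> (nat \<Rightarrow> nat) \<Rightarrow> real mat" where
  "waldspurger_matrix n \<pi> = mat (n - 1) (n - 1) (\<lambda>(i, j).
     if i \<le> j
     then (\<Sum>a\<in>{..i}. \<Sum>b\<in>{j<..<n}. permutation_matrix n \<pi> $$ (a, b))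
     else (\<Sum>a\<in>{i<..<n}. \<Sum>b\<in>{..j}. permutation_matrix n \<pi> $$ (a, b)))"

definition UM_vectors :: "nat \<Rightarrow> real vec set" where
  "UM_vectors n =
     {col (waldspurger_matrix n \<pi>) j | \<pi> j. \<pi> permutes {..<n} \<and> j < n - 1}"

end

theory Submission
  imports Defs
begin

text \<open>
  Let \<open>\<omega>\<^sub>j\<close> be the indicator vector of the coordinates \<open>0, \<dots>, j\<close>, a representative of the
  \<open>j\<close>-th fundamental coweight.  The key observation is that column \<open>j\<close> of the Waldspurger matrix
  of \<open>\<pi>\<close> lists the simple-root coordinates of \<open>\<omega>\<^sub>j - \<omega>\<^sub>j \<circ> \<pi>\<close>, the difference of \<open>\<omega>\<^sub>j\<close> and one of
  its translates under the Weyl group (\<open>simple_root_comb_col_waldspurger_matrix\<close>).  The reason is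
  that simple-root coordinates are partial sums of standard coordinates, and the two cases in the
  definition of the matrix compute the same partial sum, once from the left and once, because the
  total is 0, from the right.

  So a UM vector corresponds to a vector with entries in \<open>{0, 1}\<close> up to some position \<open>j\<close>
  and in \<open>{-1, 0}\<close> after it, with total 0.  The height bounds are read off from this shape.
  Conversely, let \<open>x\<close> be a nonzero integral vector with total 0 that obeys the bounds.  It has a
  positive and a negative entry; entries differ by at most 2, so all of them lie in
  \<open>{-1, 0, 1}\<close>; and an entry \<open>-1\<close> never precedes an entry \<open>1\<close>, as this would give a height of
  \<open>-2\<close>.  Cutting at the last entry 1 gives the shape above (\<open>separating_index\<close>), and the zero
  vector can be cut anywhere.  Finally,
  \<open>\<omega>\<^sub>j - x\<close> is the indicator vector of a set whose size is \<open>j + 1\<close> because \<open>x\<close> has total 0, and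
  a permutation that carries this set onto \<open>{0, \<dots>, j}\<close> exhibits \<open>x\<close> as
  \<open>\<omega>\<^sub>j - \<omega>\<^sub>j \<circ> \<pi>\<close> (\<open>ex_coweight_displacement\<close>).
\<close>

section \<open>Simple-root coordinates as partial sums\<close>

lemma simple_root_comb_carrier [simp]: "simple_root_comb n c \<in> carrier_vec n"
  unfolding simple_root_comb_def
  by (rule finsum_vec_closed) (auto simp: simple_root_def)

lemma index_simple_root_comb:
  assumes "k < n"
  shows "simple_root_comb n c $ k
           = (if k < n - 1 then c $ k else 0) - (if k = 0 then 0 else c $ (k - 1))"
proof -
  have "simple_root_comb n c $ k = (\<Sum>i<n - 1. (c $ i \<cdot>\<^sub>v simple_root n i) $ k)"
    unfolding simple_root_comb_def
    by (rule index_finsum_vec) (use assms in \<open>auto simp: simple_root_def\<close>)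
  also have "\<dots> = (\<Sum>i<n - 1. (if i = k then c $ i else 0) - (if i + 1 = k then c $ i else 0))"
    by (rule sum.cong) (use assms in \<open>auto simp: simple_root_def unit_vec_def\<close>)
  also have "\<dots> = (\<Sum>i<n - 1. if i = k then c $ i else 0) - (\<Sum>i<n - 1. if i + 1 = k then c $ i else 0)"
    by (rule sum_subtractf)
  also have "(\<Sum>i<n - 1. if i = k then c $ i else 0) = (if k < n - 1 then c $ k else 0)"
    by (simp add: sum.delta)
  also have "(\<Sum>i<n - 1. if i + 1 = k then c $ i else 0) = (if k = 0 then 0 else c $ (k - 1))"
    using assms by (cases k) (auto simp: sum.delta)
  finally show ?thesis .
qed

text \<open>
  The standard coordinates of \<open>\<Sum>\<^sub>i c\<^sub>i \<alpha>\<^sub>i\<close> are successive differences of \<open>c\<close>, so their sums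
  telescope.
\<close>

lemma partial_sum_simple_root_comb:
  assumes "i < n - 1"
  shows "(\<Sum>k\<le>i. simple_root_comb n c $ k) = c $ i"
  using assms
proof (induction i)
  case (Suc i)
  then show ?case by (simp add: index_simple_root_comb)
qed (simp add: index_simple_root_comb)

lemma simple_root_comb_in_ambient_space:
  assumes "n \<ge> 2"
  shows "simple_root_comb n c \<in> ambient_space n"
proof -
  obtain m where m: "n = Suc (Suc m)"
    using assms by (metis add_2_eq_Suc le_Suc_ex)
  have "(\<Sum>k<n. simple_root_comb n c $ k)
      = (\<Sum>k\<le>m. simple_root_comb n c $ k) + simple_root_comb n c $ Suc m"
    by (simp add: m lessThan_Suc_atMost)
  also have "(\<Sum>k\<le>m. simple_root_comb n c $ k) = c $ m"
    by (rule partial_sum_simple_root_comb) (simp add: m)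
  also have "c $ m + simple_root_comb n c $ Suc m = 0"
    by (simp add: index_simple_root_comb m)
  finally show ?thesis
    by (simp add: ambient_space_def)
qed

lemma inj_on_simple_root_comb: "inj_on (simple_root_comb n) (carrier_vec (n - 1))"
proof (rule inj_onI)
  fix c d assume cd: "c \<in> carrier_vec (n - 1)" "d \<in> carrier_vec (n - 1)"
    and eq: "simple_root_comb n c = simple_root_comb n d"
  show "c = d"
  proof (rule eq_vecI)
    fix i assume "i < dim_vec d"
    then have "i < n - 1" using cd by simp
    then show "c $ i = d $ i"
      using partial_sum_simple_root_comb[of i n c] partial_sum_simple_root_comb[of i n d] eq
      by simp
  qed (use cd in simp)
qed

text \<open>
  The last coordinate needs the total to vanish: it is minus the last simple-root coordinate,
  that is, minus the sum of all the other coordinates.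
\<close>

lemma simple_root_comb_partial_sums:
  assumes n: "n \<ge> 2" and sum0: "(\<Sum>k<n. x k) = 0"
  shows "simple_root_comb n (vec (n - 1) (\<lambda>i. \<Sum>k\<le>i. x k)) = vec n x"
proof (rule eq_vecI)
  fix k assume "k < dim_vec (vec n x)"
  then have k: "k < n" by simp
  show "simple_root_comb n (vec (n - 1) (\<lambda>i. \<Sum>k\<le>i. x k)) $ k = vec n x $ k"
  proof (cases k)
    case 0
    then show ?thesis using n by (simp add: index_simple_root_comb)
  next
    case (Suc m)
    show ?thesis
    proof (cases "k < n - 1")
      case True
      then show ?thesis using Suc by (simp add: index_simple_root_comb)
    next
      case False
      then have "n = Suc (Suc m)" using k Suc by simp
      then show ?thesis using Suc sum0 by (simp add: index_simple_root_comb lessThan_Suc_atMost)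
    qed
  qed
qed (simp add: carrier_vecD[OF simple_root_comb_carrier])

section \<open>Columns of Waldspurger matrices\<close>

text \<open>
  The integral vector \<open>\<omega>\<^sub>j - \<omega>\<^sub>j \<circ> \<pi>\<close>, where \<open>\<omega>\<^sub>j\<close> is the indicator vector of \<open>{..j}\<close>.
\<close>

definition coweight_displacement :: "(nat \<Rightarrow> nat) \<Rightarrow> nat \<Rightarrow> nat \<Rightarrow> int" where
  "coweight_displacement \<pi> j k = of_bool (k \<le> j) - of_bool (\<pi> k \<le> j)"

lemma sum_coweight_displacement:
  assumes "\<pi> permutes {..<n}"
  shows "(\<Sum>k<n. coweight_displacement \<pi> j k) = 0"
  using sum.permute[OF assms, of "\<lambda>k. of_bool (k \<le> j) :: int"]
  by (simp add: coweight_displacement_def sum_subtractf)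

text \<open>
  Entries of the displacement up to position \<open>j\<close> count positions \<open>a\<close> with \<open>\<pi> a > j\<close>, and those
  after \<open>j\<close> count positions with \<open>\<pi> a \<le> j\<close> negatively.  On or above the diagonal the matrix entry is
  therefore literally a partial sum of the displacement; below the diagonal it is minus the
  complementary tail sum, which is the same because the total is 0.
\<close>

lemma col_waldspurger_matrix:
  assumes \<pi>: "\<pi> permutes {..<n}" and j: "j < n - 1"
  shows "col (waldspurger_matrix n \<pi>) j
           = vec (n - 1) (\<lambda>i. \<Sum>k\<le>i. real_of_int (coweight_displacement \<pi> j k))"
proof (rule eq_vecI)
  let ?x = "\<lambda>k. real_of_int (coweight_displacement \<pi> j k)"
  fix i assume "i < dim_vec (vec (n - 1) (\<lambda>i. \<Sum>k\<le>i. ?x k))"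
  then have i: "i < n - 1" by simp
  have \<pi>_less: "\<pi> a < n" if "a < n" for a
    using permutes_in_image[OF \<pi>, of a] that by simp
  show "col (waldspurger_matrix n \<pi>) j $ i = vec (n - 1) (\<lambda>i. \<Sum>k\<le>i. ?x k) $ i"
  proof (cases "i \<le> j")
    case True
    have "col (waldspurger_matrix n \<pi>) j $ i
        = (\<Sum>a\<le>i. \<Sum>b\<in>{j<..<n}. permutation_matrix n \<pi> $$ (a, b))"
      using i j True by (simp add: waldspurger_matrix_def)
    also have "\<dots> = (\<Sum>a\<le>i. ?x a)"
    proof (rule sum.cong[OF refl])
      fix a assume "a \<in> {..i}"
      then have a: "a \<le> j" "a < n" using True i by auto
      have "(\<Sum>b\<in>{j<..<n}. permutation_matrix n \<pi> $$ (a, b))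
          = (\<Sum>b\<in>{j<..<n}. if \<pi> a = b then 1 else 0)"
        by (rule sum.cong) (use a in \<open>auto simp: permutation_matrix_def\<close>)
      also have "\<dots> = ?x a"
        using a \<pi>_less by (auto simp: sum.delta' coweight_displacement_def)
      finally show "(\<Sum>b\<in>{j<..<n}. permutation_matrix n \<pi> $$ (a, b)) = ?x a" .
    qed
    finally show ?thesis using i by simp
  next
    case False
    have "col (waldspurger_matrix n \<pi>) j $ i
        = (\<Sum>a\<in>{i<..<n}. \<Sum>b\<le>j. permutation_matrix n \<pi> $$ (a, b))"
      using i j False by (simp add: waldspurger_matrix_def)
    also have "\<dots> = (\<Sum>a\<in>{i<..<n}. - ?x a)"
    proof (rule sum.cong[OF refl])
      fix a assume "a \<in> {i<..<n}"
      then have a: "j < a" "a < n" using False by auto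
      have "(\<Sum>b\<le>j. permutation_matrix n \<pi> $$ (a, b)) = (\<Sum>b\<le>j. if \<pi> a = b then 1 else 0)"
        by (rule sum.cong) (use a j in \<open>auto simp: permutation_matrix_def\<close>)
      also have "\<dots> = - ?x a"
        using a by (auto simp: sum.delta' coweight_displacement_def)
      finally show "(\<Sum>b\<le>j. permutation_matrix n \<pi> $$ (a, b)) = - ?x a" .
    qed
    also have "\<dots> = (\<Sum>k\<le>i. ?x k)"
    proof -
      have "{..<n} = {..i} \<union> {i<..<n}" using i by auto
      then have "(\<Sum>k<n. ?x k) = (\<Sum>k\<le>i. ?x k) + (\<Sum>k\<in>{i<..<n}. ?x k)"
        by (simp add: sum.union_disjoint ivl_disj_int)
      moreover have "(\<Sum>k<n. ?x k) = 0"
        using sum_coweight_displacement[OF \<pi>, of j] by (metis of_int_0 of_int_sum)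
      ultimately show ?thesis by (simp add: sum_negf)
    qed
    finally show ?thesis using i by simp
  qed
qed (simp add: waldspurger_matrix_def)

lemma simple_root_comb_col_waldspurger_matrix:
  assumes "\<pi> permutes {..<n}" and "j < n - 1"
  shows "simple_root_comb n (col (waldspurger_matrix n \<pi>) j)
           = vec n (\<lambda>k. real_of_int (coweight_displacement \<pi> j k))"
proof -
  have "(\<Sum>k<n. real_of_int (coweight_displacement \<pi> j k)) = 0"
    using sum_coweight_displacement[OF assms(1), of j] by (metis of_int_0 of_int_sum)
  moreover have "n \<ge> 2" using assms(2) by simp
  ultimately show ?thesis
    using simple_root_comb_partial_sums by (simp only: col_waldspurger_matrix[OF assms])
qed

section \<open>Integral vectors between the hyperplanes\<close>

lemma ex_permutes_image_eq:
  assumes "finite A" "S \<subseteq> A" "T \<subseteq> A" "card S = card T"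
  shows "\<exists>\<pi>. \<pi> permutes A \<and> \<pi> ` S = T"
proof -
  have fin: "finite S" "finite T" using assms finite_subset by auto
  obtain f where f: "bij_betw f S T"
    using finite_same_card_bij fin assms(4) by blast
  have "card (A - S) = card (A - T)"
    using assms fin by (simp add: card_Diff_subset)
  then obtain g where g: "bij_betw g (A - S) (A - T)"
    using finite_same_card_bij assms(1) by blast
  define \<pi> where "\<pi> x = (if x \<in> S then f x else if x \<in> A then g x else x)" for x
  have fS: "bij_betw \<pi> S T"
    using f by (rule bij_betw_cong[THEN iffD1, rotated]) (simp add: \<pi>_def)
  have "bij_betw \<pi> (A - S) (A - T)"
    using g by (rule bij_betw_cong[THEN iffD1, rotated]) (simp add: \<pi>_def)
  with fS have "bij_betw \<pi> (S \<union> (A - S)) (T \<union> (A - T))"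
    by (rule bij_betw_combine) auto
  then have "bij_betw \<pi> A A"
    using assms by (simp add: Un_absorb1 Un_Diff_cancel)
  then have "\<pi> permutes A"
    by (rule bij_imp_permutes) (use assms in \<open>auto simp: \<pi>_def\<close>)
  then show ?thesis using fS by (auto simp: bij_betw_def)
qed

text \<open>
  The lower bound \<open>-1\<close> is what orders the entries: it excludes an entry \<open>-1\<close> to the left of an
  entry 1.  For nonzero \<open>x\<close>, the strict bound \<open>j < n - 1\<close> holds because some entry \<open>-1\<close>
  comes after the cut.
\<close>

lemma separating_index:
  fixes x :: "nat \<Rightarrow> int"
  assumes n: "n \<ge> 2" and sum0: "(\<Sum>k<n. x k) = 0"
    and bounds: "\<And>a b. a < b \<Longrightarrow> b < n \<Longrightarrow> -1 \<le> x a - x b \<and> x a - x b \<le> 2"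
  shows "\<exists>j<n - 1. \<forall>k<n. if k \<le> j then x k \<in> {0, 1} else x k \<in> {-1, 0}"
proof (cases "\<forall>k<n. x k = 0")
  case True
  then show ?thesis using n by (intro exI[of _ 0]) auto
next
  case False
  \<comment> \<open>The bounds \<open>-1\<close> and 2 together limit the spread, whichever index comes first.\<close>
  have dist: "\<bar>x a - x b\<bar> \<le> 2" if "a < n" "b < n" for a b
    using bounds[of a b] bounds[of b a] that by (cases a b rule: linorder_cases) auto
  obtain p where p: "p < n" "x p > 0"
  proof -
    have "\<exists>p<n. x p > 0"
    proof (rule ccontr)
      assume "\<not> ?thesis"
      then have "\<forall>k\<in>{..<n}. x k = 0"
        using sum0 sum_nonneg_eq_0_iff[of "{..<n}" "\<lambda>k. - x k"] by (force simp: sum_negf)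
      then show False using False by auto
    qed
    then show ?thesis using that by blast
  qed
  obtain q where q: "q < n" "x q < 0"
  proof -
    have "\<exists>q<n. x q < 0"
    proof (rule ccontr)
      assume "\<not> ?thesis"
      then have "\<forall>k\<in>{..<n}. x k = 0"
        using sum0 sum_nonneg_eq_0_iff[of "{..<n}" x] by force
      then show False using False by auto
    qed
    then show ?thesis using that by blast
  qed
  \<comment> \<open>With a positive and a negative entry, a spread of at most 2 leaves only three values.\<close>
  have range: "-1 \<le> x k \<and> x k \<le> 1" if "k < n" for k
    using dist[OF that p(1)] dist[OF that q(1)] dist[OF p(1) q(1)] p q by auto
  define j where "j = Max {k. k < n \<and> x k = 1}"
  have "p \<in> {k. k < n \<and> x k = 1}" using p range[of p] by auto
  then have "j \<in> {k. k < n \<and> x k = 1}"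
    unfolding j_def by (intro Max_in) auto
  then have j: "j < n" "x j = 1" by auto
  have after: "x k \<noteq> 1" if "j < k" "k < n" for k
    using that Max_ge[of "{k. k < n \<and> x k = 1}" k] unfolding j_def by fastforce
  have before: "x k \<noteq> -1" if "k \<le> j" for k
    using that bounds[of k j] j by (cases "k = j") auto
  have "j < q" using before[of q] q range[of q] by force
  then have "j < n - 1" using q by simp
  moreover have "if k \<le> j then x k \<in> {0, 1} else x k \<in> {-1, 0}" if "k < n" for k
    using range[OF that] before[of k] after[of k] that by auto
  ultimately show ?thesis by blast
qed

text \<open>
  If \<open>x = \<omega>\<^sub>j - \<omega>\<^sub>j \<circ> \<pi>\<close>, then \<open>\<omega>\<^sub>j - x\<close> is the indicator of \<open>{k. \<pi> k \<le> j}\<close>.  So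
  for a cut \<open>j\<close> that makes all entries of \<open>\<omega>\<^sub>j - x\<close> 0 or 1, any permutation taking the support of
  \<open>\<omega>\<^sub>j - x\<close> onto \<open>{..j}\<close> will do; the sizes agree because \<open>x\<close> has total 0.
\<close>

lemma ex_coweight_displacement:
  fixes x :: "nat \<Rightarrow> int"
  assumes n: "n \<ge> 2" and sum0: "(\<Sum>k<n. x k) = 0"
    and bounds: "\<And>a b. a < b \<Longrightarrow> b < n \<Longrightarrow> -1 \<le> x a - x b \<and> x a - x b \<le> 2"
  shows "\<exists>\<pi> j. \<pi> permutes {..<n} \<and> j < n - 1 \<and> (\<forall>k<n. x k = coweight_displacement \<pi> j k)"
proof -
  obtain j where j: "j < n - 1"
    and x: "\<And>k. k < n \<Longrightarrow> if k \<le> j then x k \<in> {0, 1} else x k \<in> {-1, 0}"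
    using separating_index[OF assms] by blast
  define S where "S = {k \<in> {..<n}. x k \<noteq> of_bool (k \<le> j)}"
  have x_eq: "x k = of_bool (k \<le> j) - of_bool (k \<in> S)" if "k < n" for k
    using x[OF that] that by (auto simp: S_def)
  have "(\<Sum>k<n. x k) = (\<Sum>k<n. of_bool (k \<le> j) - of_bool (k \<in> S))"
    by (rule sum.cong) (use x_eq in auto)
  also have "\<dots> = int (card ({..<n} \<inter> {..j})) - int (card ({..<n} \<inter> S))"
    by (simp add: sum_subtractf sum_of_bool_eq Collect_mem_eq atMost_def)
  also have "{..<n} \<inter> S = S" by (auto simp: S_def)
  also have "{..<n} \<inter> {..j} = {..j}" using j by auto
  finally have card: "card S = card {..j}" using sum0 by simp
  have "S \<subseteq> {..<n}" "{..j} \<subseteq> {..<n}" using j by (auto simp: S_def)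
  then obtain \<pi> where \<pi>: "\<pi> permutes {..<n}" "\<pi> ` S = {..j}"
    using ex_permutes_image_eq[of "{..<n}" S "{..j}"] card by auto
  have "\<pi> k \<le> j \<longleftrightarrow> k \<in> S" for k
    using inj_image_mem_iff[OF permutes_inj[OF \<pi>(1)], of k S] \<pi>(2) by simp
  then show ?thesis
    using x_eq \<pi>(1) j by (auto simp: coweight_displacement_def)
qed

section \<open>UM vectors as lattice points\<close>

lemma scalar_prod_positive_roots_iff:
  assumes "x \<in> carrier_vec n"
  shows "(\<forall>r\<in>positive_roots n. P (x \<bullet> r)) \<longleftrightarrow> (\<forall>a b. a < b \<longrightarrow> b < n \<longrightarrow> P (x $ a - x $ b))"
proof -
  have eq: "x \<bullet> (unit_vec n a - unit_vec n b) = x $ a - x $ b" if "a < b" "b < n" for a b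
    using assms that by (simp add: scalar_prod_minus_distrib[where n = n])
  show ?thesis
    unfolding positive_roots_def using eq by fastforce
qed

text \<open>
  Column \<open>j\<close> determines the vector \<open>\<omega>\<^sub>j - \<omega>\<^sub>j \<circ> \<pi>\<close> and, as the simple roots are independent,
  is determined by it.  This reduces the claim to integral vectors with total 0: a displacement
  satisfies the height bounds since \<open>\<omega>\<^sub>j\<close> is weakly decreasing, so that for \<open>a < b\<close> it contributes
  0 or 1 while \<open>\<omega>\<^sub>j \<circ> \<pi>\<close> contributes at least \<open>-1\<close> and at most 1.
\<close>

lemma UM_vector_iff:
  assumes n: "n \<ge> 2" and c: "c \<in> carrier_vec (n - 1)"
  shows "c \<in> UM_vectors n \<longleftrightarrow> simple_root_comb n c \<in> coroot_lattice n \<inter> height_polytope n"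
proof
  assume "c \<in> UM_vectors n"
  then obtain \<pi> j where \<pi>: "\<pi> permutes {..<n}" "j < n - 1"
    and c_eq: "c = col (waldspurger_matrix n \<pi>) j"
    unfolding UM_vectors_def by blast
  have comb: "simple_root_comb n c = vec n (\<lambda>k. real_of_int (coweight_displacement \<pi> j k))"
    unfolding c_eq using \<pi> by (rule simple_root_comb_col_waldspurger_matrix)
  have "c = map_vec real_of_int (vec (n - 1) (\<lambda>i. \<Sum>k\<le>i. coweight_displacement \<pi> j k))"
    unfolding c_eq col_waldspurger_matrix[OF \<pi>] by (rule eq_vecI) auto
  then have "simple_root_comb n c \<in> coroot_lattice n"
    unfolding coroot_lattice_def by fastforce
  moreover have "-1 \<le> simple_root_comb n c $ a - simple_root_comb n c $ b \<and>
      simple_root_comb n c $ a - simple_root_comb n c $ b \<le> 2" if "a < b" "b < n" for a b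
    unfolding comb using that by (auto simp: coweight_displacement_def)
  then have "simple_root_comb n c \<in> height_polytope n"
    unfolding height_polytope_def
    using simple_root_comb_in_ambient_space[OF n]
      scalar_prod_positive_roots_iff[where P = "\<lambda>t. -1 \<le> t \<and> t \<le> 2"] by simp
  ultimately show "simple_root_comb n c \<in> coroot_lattice n \<inter> height_polytope n" by blast
next
  assume asm: "simple_root_comb n c \<in> coroot_lattice n \<inter> height_polytope n"
  then obtain m where m: "m \<in> carrier_vec (n - 1)"
    and cm: "simple_root_comb n c = simple_root_comb n (map_vec real_of_int m)"
    unfolding coroot_lattice_def by blast
  \<comment> \<open>The standard coordinates of the given lattice point, as integers.\<close>
  define x where "x k = (if k < n - 1 then m $ k else 0) - (if k = 0 then 0 else m $ (k - 1))" for k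
  have x: "simple_root_comb n c $ k = real_of_int (x k)" if "k < n" for k
    unfolding cm using m that by (auto simp: index_simple_root_comb x_def)
  have "(\<Sum>k<n. real_of_int (x k)) = (\<Sum>k<n. simple_root_comb n c $ k)"
    using x by simp
  also have "\<dots> = 0"
    using simple_root_comb_in_ambient_space[OF n, of c] by (simp add: ambient_space_def)
  finally have sum0: "(\<Sum>k<n. x k) = 0"
    by (metis of_int_eq_0_iff of_int_sum)
  have "-1 \<le> x a - x b \<and> x a - x b \<le> 2" if "a < b" "b < n" for a b
  proof -
    have "-1 \<le> simple_root_comb n c $ a - simple_root_comb n c $ b \<and>
      simple_root_comb n c $ a - simple_root_comb n c $ b \<le> 2"
      using asm that scalar_prod_positive_roots_iff[where P = "\<lambda>t. -1 \<le> t \<and> t \<le> 2"]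
      by (simp add: height_polytope_def)
    then show ?thesis using that x by simp
  qed
  then obtain \<pi> j where \<pi>: "\<pi> permutes {..<n}" "j < n - 1"
    and x_eq: "\<And>k. k < n \<Longrightarrow> x k = coweight_displacement \<pi> j k"
    using ex_coweight_displacement[OF n sum0] by blast
  have "simple_root_comb n c = vec n (\<lambda>k. real_of_int (coweight_displacement \<pi> j k))"
    by (rule eq_vecI) (use x x_eq carrier_vecD[OF simple_root_comb_carrier] in auto)
  also have "\<dots> = simple_root_comb n (col (waldspurger_matrix n \<pi>) j)"
    using \<pi> by (rule simple_root_comb_col_waldspurger_matrix[symmetric])
  finally have "c = col (waldspurger_matrix n \<pi>) j"
    by (rule inj_onD[OF inj_on_simple_root_comb _ c]) (simp add: col_waldspurger_matrix[OF \<pi>])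
  then show "c \<in> UM_vectors n"
    unfolding UM_vectors_def using \<pi> by blast
qed

theorem theorem7:
  fixes n :: nat
  assumes "n \<ge> 2"
  shows "(\<forall>c \<in> carrier_vec (n - 1).
            c \<in> UM_vectors n \<longleftrightarrow>
            (\<exists>x \<in> coroot_lattice n. x = simple_root_comb n c \<and>
               (\<forall>r \<in> positive_roots n. -1 \<le> x \<bullet> r \<and> x \<bullet> r \<le> 2)))
         \<and> simple_root_comb n ` UM_vectors n = coroot_lattice n \<inter> height_polytope n"
proof
  show "\<forall>c \<in> carrier_vec (n - 1).
            c \<in> UM_vectors n \<longleftrightarrow>
            (\<exists>x \<in> coroot_lattice n. x = simple_root_comb n c \<and>
               (\<forall>r \<in> positive_roots n. -1 \<le> x \<bullet> r \<and> x \<bullet> r \<le> 2))"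
    using UM_vector_iff[OF assms] simple_root_comb_in_ambient_space[OF assms]
    by (auto simp: height_polytope_def)
  have carrier: "UM_vectors n \<subseteq> carrier_vec (n - 1)"
    by (auto simp: UM_vectors_def col_waldspurger_matrix)
  show "simple_root_comb n ` UM_vectors n = coroot_lattice n \<inter> height_polytope n"
  proof (rule equalityI)
    show "simple_root_comb n ` UM_vectors n \<subseteq> coroot_lattice n \<inter> height_polytope n"
      using UM_vector_iff[OF assms] carrier by blast
    show "coroot_lattice n \<inter> height_polytope n \<subseteq> simple_root_comb n ` UM_vectors n"
    proof
      fix x assume x: "x \<in> coroot_lattice n \<inter> height_polytope n"
      then obtain m where m: "m \<in> carrier_vec (n - 1)"
        "x = simple_root_comb n (map_vec real_of_int m)"
        unfolding coroot_lattice_def by blast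
      then have "map_vec real_of_int m \<in> UM_vectors n"
        using UM_vector_iff[OF assms, of "map_vec real_of_int m"] x by simp
      then show "x \<in> simple_root_comb n ` UM_vectors n" using m by blast
    qed
  qed
qed

end
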